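(* Let $\mathrm N_{n,2}=F_n/\gamma_3F_n$ be the free nilpotent group of rank $n$ and step $2$. Then $PI(\mathrm N_{n,2})=E\Pi A(\mathrm N_{n,2})\cap IA(\mathrm N_{n,2})=1$; that is, the only elementary palindromic automorphism of $\mathrm N_{n,2}$ that induces the identity on the abelianization of $\mathrm N_{n,2}$ is the identity automorphism.
   Context: $F_n$ is the free group on $x_1,\dots,x_n$ and $\gamma_3F_n=[[F_n,F_n],F_n]$; the images of the $x_i$ in $\mathrm N_{n,2}$ are again denoted $x_i$. For $g\in\mathrm N_{n,2}$ represented by a word $w$ in $x_1^{\pm1},\dots,x_n^{\pm1}$, $\overline g$ denotes the element represented by the reverse word (the letters of $w$ in opposite order); this is well defined. $E\Pi A(\mathrm N_{n,2})$ is the set of elementary palindromic automorphisms, i.e. automorphisms of the form $x_i\mapsto\overline{p_i}\,x_i\,p_i$ ($1\le i\le n$) with $p_1,\dots,p_n\in\mathrm N_{n,2}$. $IA(\mathrm N_{n,2})$ is the group of automorphisms of $\mathrm N_{n,2}$ inducing the identity on the abelianization. $PI(\mathrm N_{n,2})$ denotes their intersection. *)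

theory Defs
  imports "HOL-Algebra.Generated_Groups" "HOL-Algebra.Bij"
begin

section \<open>Free groups\<close>

text \<open>The letter \<open>(i, True)\<close> stands for \<open>x\<^sub>i\<close> and \<open>(i, False)\<close> for its inverse.\<close>

type_synonym letter = "nat \<times> bool"

definition letters :: "nat \<Rightarrow> letter set" where
  "letters n = {1..n} \<times> UNIV"

abbreviation words :: "nat \<Rightarrow> letter list set" where
  "words n \<equiv> lists (letters n)"

inductive_set free_eq :: "nat \<Rightarrow> (letter list \<times> letter list) set" for n where
  refl: "w \<in> words n \<Longrightarrow> (w, w) \<in> free_eq n"
| cancel: "\<lbrakk>u \<in> words n; v \<in> words n; (i, b) \<in> letters n\<rbrakk>
    \<Longrightarrow> (u @ [(i, b), (i, \<not> b)] @ v, u @ v) \<in> free_eq n"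
| sym: "(u, v) \<in> free_eq n \<Longrightarrow> (v, u) \<in> free_eq n"
| trans: "\<lbrakk>(u, v) \<in> free_eq n; (v, w) \<in> free_eq n\<rbrakk> \<Longrightarrow> (u, w) \<in> free_eq n"

definition free_group :: "nat \<Rightarrow> letter list set monoid" where
  "free_group n =
    \<lparr>carrier = words n // free_eq n,
     mult = (\<lambda>A B. \<Union>u\<in>A. \<Union>v\<in>B. free_eq n `` {u @ v}),
     one = free_eq n `` {[]}\<rparr>"

definition free_class :: "nat \<Rightarrow> letter list \<Rightarrow> letter list set" where
  "free_class n w = free_eq n `` {w}"

definition inv_word :: "letter list \<Rightarrow> letter list" where
  "inv_word w = rev (map (\<lambda>(i, b). (i, \<not> b)) w)"

lemma free_eq_words: "(u, v) \<in> free_eq n \<Longrightarrow> u \<in> words n \<and> v \<in> words n"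
  by (induction rule: free_eq.induct) (auto simp: letters_def)

lemma equiv_free_eq: "equiv (words n) (free_eq n)"
proof (rule equivI)
  show "refl_on (words n) (free_eq n)"
    by (rule refl_onI) (rule free_eq.refl)
  show "free_eq n \<subseteq> words n \<times> words n"
  proof (rule subrelI)
    fix u v assume "(u, v) \<in> free_eq n"
    from free_eq_words[OF this] show "(u, v) \<in> words n \<times> words n" by blast
  qed
  show "sym (free_eq n)"
    by (rule symI) (rule free_eq.sym)
  show "trans (free_eq n)"
    by (rule transI) (rule free_eq.trans)
qed

lemma free_eq_append_left:
  "(u, v) \<in> free_eq n \<Longrightarrow> w \<in> words n \<Longrightarrow> (w @ u, w @ v) \<in> free_eq n"
proof (induction rule: free_eq.induct)
  case (cancel u v i b)
  then show ?case
    using free_eq.cancel[of "w @ u" n v i b] by simp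
next
  case (refl x)
  then show ?case by (intro free_eq.refl) simp
next
  case (sym u v)
  then show ?case by (simp add: free_eq.sym)
next
  case (trans u v w')
  then show ?case by (metis free_eq.trans)
qed

lemma free_eq_append_right:
  "(u, v) \<in> free_eq n \<Longrightarrow> w \<in> words n \<Longrightarrow> (u @ w, v @ w) \<in> free_eq n"
proof (induction rule: free_eq.induct)
  case (cancel u v i b)
  then show ?case
    using free_eq.cancel[of u n "v @ w" i b] by simp
next
  case (refl x)
  then show ?case by (intro free_eq.refl) simp
next
  case (sym u v)
  then show ?case by (simp add: free_eq.sym)
next
  case (trans u v w')
  then show ?case by (metis free_eq.trans)
qed

lemma free_eq_append:
  assumes "(u, u') \<in> free_eq n" "(v, v') \<in> free_eq n"
  shows "(u @ v, u' @ v') \<in> free_eq n"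
proof (rule free_eq.trans)
  show "(u @ v, u' @ v) \<in> free_eq n"
    using free_eq_append_right[OF assms(1)] free_eq_words[OF assms(2)] by blast
  show "(u' @ v, u' @ v') \<in> free_eq n"
    using free_eq_append_left[OF assms(2)] free_eq_words[OF assms(1)] by blast
qed

lemma free_eq_rev: "(u, v) \<in> free_eq n \<Longrightarrow> (rev u, rev v) \<in> free_eq n"
proof (induction rule: free_eq.induct)
  case (cancel u v i b)
  then show ?case
    using free_eq.cancel[of "rev v" n "rev u" i "\<not> b"]
    by (auto simp: letters_def in_lists_conv_set)
next
  case (refl w)
  then show ?case by (intro free_eq.refl) (auto simp: in_lists_conv_set)
next
  case (sym u v)
  then show ?case by (simp add: free_eq.sym)
next
  case (trans u v w')
  then show ?case by (metis free_eq.trans)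
qed

lemma inv_word_words: "w \<in> words n \<Longrightarrow> inv_word w \<in> words n"
  by (auto simp: inv_word_def in_lists_conv_set letters_def)

lemma inv_word_cancel: "w \<in> words n \<Longrightarrow> (inv_word w @ w, []) \<in> free_eq n"
proof (induction w)
  case Nil
  then show ?case by (auto simp: inv_word_def intro: free_eq.refl)
next
  case (Cons a w)
  obtain i b where a: "a = (i, b)" by fastforce
  have "(inv_word w @ [(i, \<not> b), (i, \<not> \<not> b)] @ w, inv_word w @ w) \<in> free_eq n"
    using Cons.prems by (intro free_eq.cancel inv_word_words) (auto simp: a letters_def)
  moreover have "(inv_word w @ w, []) \<in> free_eq n"
    using Cons by simp
  ultimately have "(inv_word w @ [(i, \<not> b), (i, \<not> \<not> b)] @ w, []) \<in> free_eq n"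
    by (rule free_eq.trans)
  then show ?case by (simp add: a inv_word_def)
qed

lemma free_class_eq_iff:
  "u \<in> words n \<Longrightarrow> v \<in> words n \<Longrightarrow> free_class n u = free_class n v \<longleftrightarrow> (u, v) \<in> free_eq n"
  by (simp add: free_class_def eq_equiv_class_iff[OF equiv_free_eq])

lemma carrier_free_group: "carrier (free_group n) = free_class n ` words n"
  by (auto simp: free_group_def free_class_def quotient_def)

lemma one_free_group: "\<one>\<^bsub>free_group n\<^esub> = free_class n []"
  by (simp add: free_group_def free_class_def)

lemma mult_free_class:
  assumes "u \<in> words n" "v \<in> words n"
  shows "free_class n u \<otimes>\<^bsub>free_group n\<^esub> free_class n v = free_class n (u @ v)"
proof -
  have "free_class n (u' @ v') = free_class n (u @ v)"
    if "u' \<in> free_class n u" "v' \<in> free_class n v" for u' v'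
    using that equiv_class_eq[OF equiv_free_eq free_eq_append[of u u' n v v']]
    by (simp add: free_class_def)
  then have "(\<Union>u'\<in>free_class n u. \<Union>v'\<in>free_class n v. free_class n (u' @ v'))
      = (\<Union>u'\<in>free_class n u. \<Union>v'\<in>free_class n v. free_class n (u @ v))"
    by (meson SUP_cong HOL.refl)
  moreover have "u \<in> free_class n u" "v \<in> free_class n v"
    using assms free_eq.refl by (auto simp: free_class_def)
  ultimately show ?thesis
    by (auto simp: free_group_def free_class_def)
qed

lemma group_free_group: "group (free_group n)"
proof (rule groupI)
  fix x assume "x \<in> carrier (free_group n)"
  then obtain u where u: "u \<in> words n" "x = free_class n u"
    by (auto simp: carrier_free_group)
  have "free_class n (inv_word u) \<otimes>\<^bsub>free_group n\<^esub> x = \<one>\<^bsub>free_group n\<^esub>"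
    using u inv_word_words[OF u(1)] inv_word_cancel[OF u(1)]
    by (simp add: mult_free_class one_free_group free_class_eq_iff)
  then show "\<exists>y\<in>carrier (free_group n). y \<otimes>\<^bsub>free_group n\<^esub> x = \<one>\<^bsub>free_group n\<^esub>"
    using inv_word_words[OF u(1)] by (auto simp: carrier_free_group)
next
  fix x y assume "x \<in> carrier (free_group n)" "y \<in> carrier (free_group n)"
  then obtain u v where "u \<in> words n" "v \<in> words n" "x = free_class n u" "y = free_class n v"
    by (auto simp only: carrier_free_group)
  then show "x \<otimes>\<^bsub>free_group n\<^esub> y \<in> carrier (free_group n)"
    by (simp add: mult_free_class carrier_free_group)
next
  fix x y z
  assume "x \<in> carrier (free_group n)" "y \<in> carrier (free_group n)" "z \<in> carrier (free_group n)"
  then obtain u v w where "u \<in> words n" "v \<in> words n" "w \<in> words n"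
      "x = free_class n u" "y = free_class n v" "z = free_class n w"
    by (auto simp only: carrier_free_group)
  then show "x \<otimes>\<^bsub>free_group n\<^esub> y \<otimes>\<^bsub>free_group n\<^esub> z = x \<otimes>\<^bsub>free_group n\<^esub> (y \<otimes>\<^bsub>free_group n\<^esub> z)"
    by (simp add: mult_free_class)
next
  fix x assume "x \<in> carrier (free_group n)"
  then obtain u where "u \<in> words n" "x = free_class n u"
    by (auto simp only: carrier_free_group)
  then show "\<one>\<^bsub>free_group n\<^esub> \<otimes>\<^bsub>free_group n\<^esub> x = x"
    by (simp add: mult_free_class one_free_group)
next
  show "\<one>\<^bsub>free_group n\<^esub> \<in> carrier (free_group n)"
    by (simp add: one_free_group carrier_free_group)
qed


section \<open>Free nilpotent groups of step 2\<close>

definition gamma3 :: "('a, 'b) monoid_scheme \<Rightarrow> 'a set" where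
  "gamma3 G = generate G
    (\<Union>h \<in> derived G (carrier G). \<Union>k \<in> carrier G.
      {h \<otimes>\<^bsub>G\<^esub> k \<otimes>\<^bsub>G\<^esub> inv\<^bsub>G\<^esub> h \<otimes>\<^bsub>G\<^esub> inv\<^bsub>G\<^esub> k})"

definition free_nil2 :: "nat \<Rightarrow> letter list set set monoid" where
  "free_nil2 n = free_group n Mod gamma3 (free_group n)"

definition nil2_class :: "nat \<Rightarrow> letter list \<Rightarrow> letter list set set" where
  "nil2_class n w = gamma3 (free_group n) #>\<^bsub>free_group n\<^esub> free_class n w"

definition nil2_gen :: "nat \<Rightarrow> nat \<Rightarrow> letter list set set" where
  "nil2_gen n i = nil2_class n [(i, True)]"

definition nil2_rev :: "nat \<Rightarrow> letter list set set \<Rightarrow> letter list set set" where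
  "nil2_rev n g = (THE h. \<exists>w \<in> words n. g = nil2_class n w \<and> h = nil2_class n (rev w))"

lemma (in group) hom_gamma3:
  assumes f: "f \<in> hom G G" and c: "c \<in> gamma3 G"
  shows "f c \<in> gamma3 G"
proof -
  interpret f: group_hom G G f
    using f by unfold_locales
  let ?S = "\<Union>h \<in> derived G (carrier G). \<Union>k \<in> carrier G. {h \<otimes> k \<otimes> inv h \<otimes> inv k}"
  have D: "derived G (carrier G) \<subseteq> carrier G"
    by (simp add: derived_in_carrier)
  have fD: "f h \<in> derived G (carrier G)" if "h \<in> derived G (carrier G)" for h
  proof -
    have "f h \<in> derived G (f ` carrier G)"
      using that f.derived_img[of "carrier G"] by auto
    also have "\<dots> \<subseteq> derived G (carrier G)"
      by (rule mono_derived) auto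
    finally show ?thesis .
  qed
  have "f ` ?S \<subseteq> ?S"
  proof (clarsimp)
    fix h k assume hk: "h \<in> derived G (carrier G)" "k \<in> carrier G"
    then have "h \<in> carrier G" using D by auto
    with hk show "\<exists>x\<in>derived G (carrier G). \<exists>y\<in>carrier G.
        f (h \<otimes> k \<otimes> inv h \<otimes> inv k) = x \<otimes> y \<otimes> inv x \<otimes> inv y"
      by (intro bexI[of _ "f h"] bexI[of _ "f k"]) (auto simp: fD)
  qed
  then have "generate G (f ` ?S) \<subseteq> generate G ?S"
    by (rule mono_generate)
  moreover have "generate G (f ` ?S) = f ` generate G ?S"
    using D by (intro f.generate_img) auto
  ultimately show ?thesis
    using c unfolding gamma3_def by auto
qed

lemma (in group) gamma3_normal: "gamma3 G \<lhd> G"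
proof (rule normal_invI)
  have "derived G (carrier G) \<subseteq> carrier G"
    by (simp add: derived_in_carrier)
  then have D: "h \<in> carrier G" if "h \<in> derived G (carrier G)" for h
    using that by blast
  show "subgroup (gamma3 G) G"
    unfolding gamma3_def by (rule generate_is_subgroup) (auto dest: D)
next
  fix g c assume g: "g \<in> carrier G" and c: "c \<in> gamma3 G"
  have canc: "inv g \<otimes> (g \<otimes> x) = x" if "x \<in> carrier G" for x
    using g that by (simp add: m_assoc[symmetric])
  have "(\<lambda>x. g \<otimes> x \<otimes> inv g) \<in> hom G G"
    using g by (intro homI) (simp_all add: m_assoc canc)
  from hom_gamma3[OF this c] show "g \<otimes> c \<otimes> inv g \<in> gamma3 G" .
qed

lemma group_free_nil2: "group (free_nil2 n)"
  unfolding free_nil2_def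
  by (intro normal.factorgroup_is_group group.gamma3_normal group_free_group)

lemma carrier_free_nil2: "carrier (free_nil2 n) = nil2_class n ` words n"
  by (auto simp: free_nil2_def carrier_FactGroup carrier_free_group nil2_class_def)

text \<open>Reversal of words is a well-defined operation on the free nilpotent group.\<close>

lemma nil2_class_rev:
  assumes u: "u \<in> words n" and v: "v \<in> words n" and eq: "nil2_class n u = nil2_class n v"
  shows "nil2_class n (rev u) = nil2_class n (rev v)"
proof -
  let ?F = "free_group n"
  let ?c = "free_class n"
  interpret F: group ?F by (rule group_free_group)
  interpret N: normal "gamma3 ?F" ?F by (rule F.gamma3_normal)
  have revw: "rev w \<in> words n" if "w \<in> words n" for w
    using that by (auto simp: in_lists_conv_set)
  have cF: "?c w \<in> carrier ?F" if "w \<in> words n" for w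
    using that by (auto simp: carrier_free_group)
  define s where "s A = inv\<^bsub>?F\<^esub> (?c (rev (SOME w. w \<in> words n \<and> A = ?c w)))" for A
  have s: "s (?c w) = inv\<^bsub>?F\<^esub> (?c (rev w))" if w: "w \<in> words n" for w
  proof -
    let ?w = "SOME w'. w' \<in> words n \<and> ?c w = ?c w'"
    have "?w \<in> words n \<and> ?c w = ?c ?w"
      by (rule someI[of _ w]) (use w in simp)
    then have ww: "?w \<in> words n" and "free_class n ?w = free_class n w"
      by auto
    then have "(?w, w) \<in> free_eq n"
      using free_class_eq_iff[OF ww w] by blast
    then have "?c (rev ?w) = ?c (rev w)"
      using free_class_eq_iff[OF revw[OF ww] revw[OF w]] free_eq_rev by blast
    then show ?thesis by (simp add: s_def)
  qed
  have shom: "s \<in> hom ?F ?F"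
  proof (rule homI)
    fix x assume "x \<in> carrier ?F"
    then obtain a where "a \<in> words n" "x = ?c a"
      by (auto simp only: carrier_free_group)
    then show "s x \<in> carrier ?F"
      using s cF[OF revw] by simp
  next
    fix x y assume "x \<in> carrier ?F" "y \<in> carrier ?F"
    then obtain a b where ab: "a \<in> words n" "b \<in> words n" "x = ?c a" "y = ?c b"
      by (auto simp: carrier_free_group)
    have "s (x \<otimes>\<^bsub>?F\<^esub> y) = inv\<^bsub>?F\<^esub> (?c (rev b @ rev a))"
      using ab s[of "a @ b"] by (simp add: mult_free_class)
    also have "\<dots> = inv\<^bsub>?F\<^esub> (?c (rev b) \<otimes>\<^bsub>?F\<^esub> ?c (rev a))"
      using mult_free_class[OF revw[OF ab(2)] revw[OF ab(1)]] by simp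
    also have "\<dots> = s x \<otimes>\<^bsub>?F\<^esub> s y"
      using F.inv_mult_group[OF cF[OF revw[OF ab(2)]] cF[OF revw[OF ab(1)]]] s ab by simp
    finally show "s (x \<otimes>\<^bsub>?F\<^esub> y) = s x \<otimes>\<^bsub>?F\<^esub> s y" .
  qed
  interpret s: group_hom ?F ?F s
    using shom by unfold_locales
  have "?c u \<in> gamma3 ?F #>\<^bsub>?F\<^esub> ?c v"
    using eq F.rcos_self[OF cF[OF u] N.subgroup_axioms] by (simp add: nil2_class_def)
  then obtain c where c: "c \<in> gamma3 ?F" "?c u = c \<otimes>\<^bsub>?F\<^esub> ?c v"
    by (auto simp: r_coset_def)
  have cc: "c \<in> carrier ?F" using c by simp
  have sc: "s c \<in> gamma3 ?F" by (rule F.hom_gamma3[OF shom c(1)])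
  have "?c (rev u) = inv\<^bsub>?F\<^esub> (s (?c u))"
    using u cF revw by (simp add: s)
  also have "\<dots> = inv\<^bsub>?F\<^esub> (s c \<otimes>\<^bsub>?F\<^esub> inv\<^bsub>?F\<^esub> (?c (rev v)))"
    using cc v cF by (simp add: c(2) s)
  also have "\<dots> = ?c (rev v) \<otimes>\<^bsub>?F\<^esub> inv\<^bsub>?F\<^esub> (s c)"
    using sc cF[OF revw[OF v]] by (simp add: F.inv_mult_group)
  finally have e: "?c (rev u) = ?c (rev v) \<otimes>\<^bsub>?F\<^esub> inv\<^bsub>?F\<^esub> (s c)" .
  have "?c (rev u) \<in> ?c (rev v) <#\<^bsub>?F\<^esub> gamma3 ?F"
    using sc by (auto simp: e l_coset_def)
  then have "?c (rev u) \<in> gamma3 ?F #>\<^bsub>?F\<^esub> ?c (rev v)"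
    using N.coset_eq cF[OF revw[OF v]] by simp
  then show ?thesis
    unfolding nil2_class_def
    using F.repr_independence[OF _ cF[OF revw[OF v]] N.subgroup_axioms] by simp
qed

lemma nil2_rev_nil2_class:
  assumes "w \<in> words n"
  shows "nil2_rev n (nil2_class n w) = nil2_class n (rev w)"
  unfolding nil2_rev_def
proof (rule the_equality)
  show "\<exists>v \<in> words n. nil2_class n w = nil2_class n v \<and> nil2_class n (rev w) = nil2_class n (rev v)"
    using assms by (intro bexI[of _ w]) auto
next
  fix h assume "\<exists>v \<in> words n. nil2_class n w = nil2_class n v \<and> h = nil2_class n (rev v)"
  then show "h = nil2_class n (rev w)"
    using nil2_class_rev[OF assms] by metis
qed


section \<open>Palindromic and IA-automorphisms\<close>

definition elem_pal_auto :: "nat \<Rightarrow> (letter list set set \<Rightarrow> letter list set set) set" where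
  "elem_pal_auto n = {f \<in> auto (free_nil2 n).
    \<exists>p \<in> {1..n} \<rightarrow> carrier (free_nil2 n). \<forall>i \<in> {1..n}.
      f (nil2_gen n i) = nil2_rev n (p i) \<otimes>\<^bsub>free_nil2 n\<^esub> nil2_gen n i \<otimes>\<^bsub>free_nil2 n\<^esub> p i}"

definition IA_auto :: "('a, 'b) monoid_scheme \<Rightarrow> ('a \<Rightarrow> 'a) set" where
  "IA_auto G = {f \<in> auto G. \<forall>g \<in> carrier G.
    derived G (carrier G) #>\<^bsub>G\<^esub> f g = derived G (carrier G) #>\<^bsub>G\<^esub> g}"

definition PI_auto :: "nat \<Rightarrow> (letter list set set \<Rightarrow> letter list set set) set" where
  "PI_auto n = elem_pal_auto n \<inter> IA_auto (free_nil2 n)"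

end

theory Submission
  imports Defs
begin

text \<open>
  Write \<open>N\<close> for the free nilpotent group of step 2 and \<open>N'\<close> for its derived subgroup, which is central.
  Two facts drive the proof.

  First, \<open>N / N'\<close> is free abelian, hence without 2-torsion. If \<open>x\<^sub>i \<mapsto> rev(p) x\<^sub>i p\<close> is trivial modulo
  \<open>N'\<close>, then \<open>rev(p) p\<close>, and with it \<open>p\<^sup>2\<close>, lies in \<open>N'\<close>, because reversal is trivial on the
  abelianization; therefore \<open>p\<close> itself lies in \<open>N'\<close>. The computation is done with exponent sums:
  \<open>nil2_class_in_derived_iff\<close> says that a word represents an element of \<open>N'\<close> exactly if all its
  exponent sums vanish, and the sums for \<open>rev(p) p\<close> are twice those for \<open>p\<close>.

  Second, reversal inverts every element of \<open>N'\<close> (\<open>nil2_rev_derived\<close>). The map \<open>g \<mapsto> rev(g)\<^sup>-\<^sup>1\<close> is an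
  endomorphism that acts as inversion modulo the central subgroup \<open>N'\<close>, so it sends a commutator
  \<open>[a, b]\<close> to \<open>[a\<^sup>-\<^sup>1, b\<^sup>-\<^sup>1]\<close>, which equals \<open>[a, b]\<close>: the commutator is bilinear and the two signs cancel.

  Together they give \<open>rev(p) x\<^sub>i p = p\<^sup>-\<^sup>1 x\<^sub>i p = x\<^sub>i\<close> for every \<open>i\<close>, so the automorphism is the identity.
\<close>

section \<open>Commutators in groups with central derived subgroup\<close>

lemma (in group) commutator_in_derived:
  assumes "a \<in> carrier G" "b \<in> carrier G"
  shows "a \<otimes> b \<otimes> inv a \<otimes> inv b \<in> derived G (carrier G)"
  using assms unfolding derived_def by (intro generate.incl) auto

lemma (in group) gamma3_subset_derived: "gamma3 G \<subseteq> derived G (carrier G)"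
  using derived_in_carrier[of "carrier G"]
  unfolding gamma3_def derived_def[of G "carrier G"]
  by (intro mono_generate) (auto simp: derived_def)

lemma (in group) inv_mult_cancel:
  assumes "x \<in> carrier G" "y \<in> carrier G"
  shows "inv x \<otimes> (x \<otimes> y) = y" "x \<otimes> (inv x \<otimes> y) = y"
  using assms by (simp_all flip: m_assoc)

lemma (in group) commutator_central_factors:
  assumes z: "z \<in> carrier G" "\<And>g. g \<in> carrier G \<Longrightarrow> z \<otimes> g = g \<otimes> z"
    and w: "w \<in> carrier G" "\<And>g. g \<in> carrier G \<Longrightarrow> w \<otimes> g = g \<otimes> w"
    and [simp]: "a \<in> carrier G" "b \<in> carrier G"
  shows "(z \<otimes> a) \<otimes> (w \<otimes> b) \<otimes> inv (z \<otimes> a) \<otimes> inv (w \<otimes> b) = a \<otimes> b \<otimes> inv a \<otimes> inv b"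
proof -
  note [simp] = z(1) w(1)
  have "(z \<otimes> a) \<otimes> (w \<otimes> b) = (a \<otimes> b) \<otimes> (w \<otimes> z)"
    using z(2)[of "a \<otimes> (w \<otimes> b)"] w(2)[of b] by (simp add: m_assoc)
  moreover have "inv (z \<otimes> a) = inv z \<otimes> inv a"
    using z(2)[of a] by (simp add: inv_mult_group)
  moreover have "inv (w \<otimes> b) = inv b \<otimes> inv w"
    by (simp add: inv_mult_group)
  moreover have "w \<otimes> (inv a \<otimes> (inv b \<otimes> inv w)) = inv a \<otimes> inv b"
  proof -
    have "w \<otimes> (inv a \<otimes> (inv b \<otimes> inv w)) = w \<otimes> (inv a \<otimes> inv b) \<otimes> inv w"
      by (simp add: m_assoc)
    also have "\<dots> = inv a \<otimes> inv b"
      unfolding w(2)[of "inv a \<otimes> inv b", simplified] by (simp add: m_assoc)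
    finally show ?thesis .
  qed
  ultimately show ?thesis
    by (simp add: m_assoc inv_mult_cancel)
qed

text \<open>
  Modulo central factors such an endomorphism replaces \<open>[a, b]\<close> by \<open>[a\<^sup>-\<^sup>1, b\<^sup>-\<^sup>1]\<close>, and
  \<open>[a\<^sup>-\<^sup>1, b\<^sup>-\<^sup>1]\<close> is a conjugate of \<open>[a, b]\<close>, hence equal to it if commutators are central.
\<close>

lemma (in group) endomorphism_inverting_abelianization_fixes_derived:
  assumes s: "s \<in> hom G G"
    and central: "\<And>h k. \<lbrakk>h \<in> derived G (carrier G); k \<in> carrier G\<rbrakk> \<Longrightarrow> h \<otimes> k = k \<otimes> h"
    and invert: "\<And>a. a \<in> carrier G \<Longrightarrow> s a \<otimes> a \<in> derived G (carrier G)"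
    and d: "d \<in> derived G (carrier G)"
  shows "s d = d"
proof -
  interpret s: group_hom G G s
    using s by unfold_locales
  have D: "h \<in> carrier G" if "h \<in> derived G (carrier G)" for h
    using that derived_in_carrier by blast
  have comm: "s (a \<otimes> b \<otimes> inv a \<otimes> inv b) = a \<otimes> b \<otimes> inv a \<otimes> inv b"
    if [simp]: "a \<in> carrier G" "b \<in> carrier G" for a b
  proof -
    let ?k = "inv a \<otimes> inv b \<otimes> inv (inv a) \<otimes> inv (inv b)"
    have sinv: "s x = (s x \<otimes> x) \<otimes> inv x" if "x \<in> carrier G" for x
      using that by (simp add: m_assoc)
    have "s (a \<otimes> b \<otimes> inv a \<otimes> inv b) = s a \<otimes> s b \<otimes> inv (s a) \<otimes> inv (s b)"
      by simp
    also have "\<dots> = ?k"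
    proof -
      have "(s a \<otimes> a) \<otimes> inv a \<otimes> ((s b \<otimes> b) \<otimes> inv b) \<otimes> inv ((s a \<otimes> a) \<otimes> inv a)
          \<otimes> inv ((s b \<otimes> b) \<otimes> inv b) = ?k"
        by (rule commutator_central_factors) (rule central invert | simp)+
      then show ?thesis
        by (simp only: sinv[OF that(1), symmetric] sinv[OF that(2), symmetric])
    qed
    also have "\<dots> = ?k \<otimes> (b \<otimes> a) \<otimes> inv (b \<otimes> a)"
      by (simp add: m_assoc)
    also have "\<dots> = (b \<otimes> a) \<otimes> ?k \<otimes> inv (b \<otimes> a)"
      using central[of ?k "b \<otimes> a"] commutator_in_derived[of "inv a" "inv b"] by simp
    also have "\<dots> = a \<otimes> b \<otimes> inv a \<otimes> inv b"
      by (simp add: m_assoc inv_mult_cancel inv_mult_group)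
    finally show ?thesis .
  qed
  from d have "d \<in> carrier G \<and> s d = d"
    unfolding derived_def
  proof (induction rule: generate.induct)
    case (incl h)
    then show ?case using comm by auto
  next
    case (inv h)
    then obtain a b where ab: "a \<in> carrier G" "b \<in> carrier G" "h = a \<otimes> b \<otimes> inv a \<otimes> inv b"
      by auto
    then have "h \<in> carrier G" "s h = h"
      using comm[of a b] by simp_all
    then show ?case by simp
  qed auto
  then show ?thesis ..
qed


section \<open>Exponent sums and the derived subgroup\<close>

definition exponent_sum :: "nat \<Rightarrow> letter list \<Rightarrow> int" where
  "exponent_sum j w = int (count_list w (j, True)) - int (count_list w (j, False))"

lemma exponent_sum_Nil [simp]: "exponent_sum j [] = 0"
  by (simp add: exponent_sum_def)

lemma exponent_sum_append [simp]:
  "exponent_sum j (u @ v) = exponent_sum j u + exponent_sum j v"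
  by (simp add: exponent_sum_def)

lemma exponent_sum_Cons: "exponent_sum j (x # w) = exponent_sum j [x] + exponent_sum j w"
  using exponent_sum_append[of j "[x]" w] by simp

lemma exponent_sum_rev [simp]: "exponent_sum j (rev w) = exponent_sum j w"
  by (simp add: exponent_sum_def)

lemma exponent_sum_flip: "exponent_sum j [(i, \<not> b)] = - exponent_sum j [(i, b)]"
  by (simp add: exponent_sum_def)

lemma exponent_sum_inv_word [simp]: "exponent_sum j (inv_word w) = - exponent_sum j w"
proof (induction w)
  case (Cons x w)
  obtain i b where "x = (i, b)" by fastforce
  with Cons show ?case
    by (simp add: inv_word_def exponent_sum_flip exponent_sum_Cons[of j "(i, b)" w])
qed (simp add: inv_word_def)

lemma exponent_sum_free_eq: "(u, v) \<in> free_eq n \<Longrightarrow> exponent_sum j u = exponent_sum j v"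
proof (induction rule: free_eq.induct)
  case (cancel u v i b)
  then show ?case
    by (cases b) (auto simp: exponent_sum_def)
qed auto

lemma free_class_in_carrier: "w \<in> words n \<Longrightarrow> free_class n w \<in> carrier (free_group n)"
  by (simp add: carrier_free_group)

lemma inv_free_class:
  assumes "w \<in> words n"
  shows "inv\<^bsub>free_group n\<^esub> free_class n w = free_class n (inv_word w)"
proof -
  interpret F: group "free_group n" by (rule group_free_group)
  have "free_class n (inv_word w) \<otimes>\<^bsub>free_group n\<^esub> free_class n w = \<one>\<^bsub>free_group n\<^esub>"
    using assms inv_word_words[OF assms] inv_word_cancel[OF assms]
    by (simp add: mult_free_class one_free_group free_class_eq_iff)
  then show ?thesis
    using assms inv_word_words[OF assms] by (intro F.inv_equality free_class_in_carrier)
qed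

lemma exponent_sum_derived:
  assumes w: "w \<in> words n"
    and d: "free_class n w \<in> derived (free_group n) (carrier (free_group n))"
  shows "exponent_sum j w = 0"
proof -
  let ?F = "free_group n"
  have comm: "\<exists>v \<in> words n. h = free_class n v \<and> exponent_sum j v = 0"
    if "h \<in> derived_set ?F (carrier ?F)" for h
  proof -
    from that obtain a b where ab: "a \<in> words n" "b \<in> words n" and h:
      "h = free_class n a \<otimes>\<^bsub>?F\<^esub> free_class n b \<otimes>\<^bsub>?F\<^esub> inv\<^bsub>?F\<^esub> free_class n a \<otimes>\<^bsub>?F\<^esub> inv\<^bsub>?F\<^esub> free_class n b"
      by (auto simp: carrier_free_group)
    note wds = ab ab[THEN inv_word_words]
    have "h = free_class n (a @ b @ inv_word a @ inv_word b)"
      using wds by (simp add: h inv_free_class mult_free_class)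
    then show ?thesis
      using wds by (intro bexI[of _ "a @ b @ inv_word a @ inv_word b"]) simp_all
  qed
  have "\<exists>v \<in> words n. g = free_class n v \<and> exponent_sum j v = 0"
    if "g \<in> derived ?F (carrier ?F)" for g
    using that unfolding derived_def
  proof (induction rule: generate.induct)
    case one
    show ?case by (intro bexI[of _ "[]"]) (simp_all add: one_free_group)
  next
    case (incl h)
    then show ?case by (rule comm)
  next
    case (inv h)
    then obtain v where "v \<in> words n" "h = free_class n v" "exponent_sum j v = 0"
      using comm by blast
    then show ?case
      by (intro bexI[of _ "inv_word v"]) (simp_all add: inv_free_class inv_word_words)
  next
    case (eng h k)
    then obtain u v where "u \<in> words n" "h = free_class n u" "exponent_sum j u = 0"
      "v \<in> words n" "k = free_class n v" "exponent_sum j v = 0"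
      by blast
    then show ?case
      by (intro bexI[of _ "u @ v"]) (simp_all add: mult_free_class)
  qed
  from this[OF d] obtain v where "v \<in> words n" "free_class n w = free_class n v"
    "exponent_sum j v = 0"
    by blast
  with w show ?thesis
    using exponent_sum_free_eq[of w v n j] by (simp add: free_class_eq_iff)
qed

text \<open>
  If all exponent sums vanish, the first letter \<open>x\<close> is matched by an inverse letter further on, and
  \<open>x v x\<^sup>-\<^sup>1 v' = [x, v] v v'\<close> removes the pair at the cost of one commutator.
\<close>

lemma derived_if_exponent_sum_zero:
  assumes "w \<in> words n" "\<And>j. exponent_sum j w = 0"
  shows "free_class n w \<in> derived (free_group n) (carrier (free_group n))"
  using assms
proof (induction w rule: length_induct)
  case (1 w)
  let ?F = "free_group n"
  interpret F: group ?F by (rule group_free_group)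
  interpret D: subgroup "derived ?F (carrier ?F)" ?F
    by (rule F.derived_is_subgroup) simp
  show ?case
  proof (cases w)
    case Nil
    then show ?thesis using D.one_closed by (simp add: one_free_group)
  next
    case (Cons x v)
    obtain i b where x: "x = (i, b)" by fastforce
    have "count_list w (i, True) = count_list w (i, False)"
      using "1.prems"(2)[of i] by (simp add: exponent_sum_def)
    then have "count_list w (i, \<not> b) = count_list w (i, b)"
      by (cases b) simp_all
    then have "count_list w (i, \<not> b) \<noteq> 0"
      by (simp add: Cons x)
    then have "(i, \<not> b) \<in> set w"
      by (metis count_notin)
    then have "(i, \<not> b) \<in> set v"
      by (auto simp: Cons x)
    then obtain v1 v2 where v: "v = v1 @ (i, \<not> b) # v2"
      by (auto simp: in_set_conv_decomp)
    have wds: "[x] \<in> words n" "v1 \<in> words n" "v2 \<in> words n" "inv_word [x] \<in> words n"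
      using "1.prems"(1) by (auto simp: Cons v x inv_word_def)
    note cls = wds[THEN free_class_in_carrier]
    let ?k = "free_class n [x] \<otimes>\<^bsub>?F\<^esub> free_class n v1 \<otimes>\<^bsub>?F\<^esub> inv\<^bsub>?F\<^esub> free_class n [x]
      \<otimes>\<^bsub>?F\<^esub> inv\<^bsub>?F\<^esub> free_class n v1"
    have "free_class n w = free_class n [x] \<otimes>\<^bsub>?F\<^esub> free_class n v1 \<otimes>\<^bsub>?F\<^esub> inv\<^bsub>?F\<^esub> free_class n [x]
      \<otimes>\<^bsub>?F\<^esub> free_class n v2"
      using wds by (simp add: inv_free_class mult_free_class) (simp add: Cons v x inv_word_def)
    also have "\<dots> = ?k \<otimes>\<^bsub>?F\<^esub> (free_class n v1 \<otimes>\<^bsub>?F\<^esub> free_class n v2)"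
      using cls by (simp add: F.m_assoc F.inv_mult_cancel)
    also have "free_class n v1 \<otimes>\<^bsub>?F\<^esub> free_class n v2 = free_class n (v1 @ v2)"
      using wds by (simp add: mult_free_class)
    finally have w: "free_class n w = ?k \<otimes>\<^bsub>?F\<^esub> free_class n (v1 @ v2)" .
    have "exponent_sum j (v1 @ v2) = 0" for j
      using "1.prems"(2)[of j] exponent_sum_Cons[of j x v] exponent_sum_flip[of j i b]
        exponent_sum_Cons[of j "(i, \<not> b)" v2]
      by (simp add: Cons v x)
    moreover have "length (v1 @ v2) < length w" "v1 @ v2 \<in> words n"
      using wds by (simp_all add: Cons v)
    ultimately have "free_class n (v1 @ v2) \<in> derived ?F (carrier ?F)"
      using "1.IH" by blast
    then show ?thesis
      unfolding w using cls by (intro D.m_closed F.commutator_in_derived)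
  qed
qed


section \<open>The free nilpotent group of step 2\<close>

lemma group_hom_nil2_projection:
  "group_hom (free_group n) (free_nil2 n) (\<lambda>x. gamma3 (free_group n) #>\<^bsub>free_group n\<^esub> x)"
  unfolding free_nil2_def
  by (intro group_hom.intro group_hom_axioms.intro normal.r_coset_hom_Mod group.gamma3_normal
      normal.factorgroup_is_group group_free_group)

lemma derived_free_nil2:
  "derived (free_nil2 n) (carrier (free_nil2 n)) =
    (\<lambda>x. gamma3 (free_group n) #>\<^bsub>free_group n\<^esub> x) ` derived (free_group n) (carrier (free_group n))"
  using group_hom.derived_img[OF group_hom_nil2_projection, of "carrier (free_group n)"]
  by (simp add: free_nil2_def carrier_FactGroup)

lemma nil2_class_in_carrier: "w \<in> words n \<Longrightarrow> nil2_class n w \<in> carrier (free_nil2 n)"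
  by (simp add: carrier_free_nil2)

lemma mult_nil2_class:
  assumes "u \<in> words n" "v \<in> words n"
  shows "nil2_class n u \<otimes>\<^bsub>free_nil2 n\<^esub> nil2_class n v = nil2_class n (u @ v)"
proof -
  interpret P: group_hom "free_group n" "free_nil2 n" "\<lambda>x. gamma3 (free_group n) #>\<^bsub>free_group n\<^esub> x"
    by (rule group_hom_nil2_projection)
  show ?thesis
    using P.hom_mult[OF free_class_in_carrier[OF assms(1)] free_class_in_carrier[OF assms(2)]] assms
    by (simp add: nil2_class_def mult_free_class)
qed

lemma inv_nil2_class:
  assumes "w \<in> words n"
  shows "inv\<^bsub>free_nil2 n\<^esub> nil2_class n w = nil2_class n (inv_word w)"
proof -
  interpret P: group_hom "free_group n" "free_nil2 n" "\<lambda>x. gamma3 (free_group n) #>\<^bsub>free_group n\<^esub> x"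
    by (rule group_hom_nil2_projection)
  show ?thesis
    using P.hom_inv[OF free_class_in_carrier[OF assms]] assms
    by (simp add: nil2_class_def inv_free_class)
qed

lemma one_nil2_class: "\<one>\<^bsub>free_nil2 n\<^esub> = nil2_class n []"
proof -
  interpret P: group_hom "free_group n" "free_nil2 n" "\<lambda>x. gamma3 (free_group n) #>\<^bsub>free_group n\<^esub> x"
    by (rule group_hom_nil2_projection)
  show ?thesis
    using P.hom_one by (simp add: nil2_class_def one_free_group)
qed

text \<open>The exponent sums are coordinates on the abelianization of the free nilpotent group.\<close>

lemma nil2_class_in_derived_iff:
  assumes w: "w \<in> words n"
  shows "nil2_class n w \<in> derived (free_nil2 n) (carrier (free_nil2 n))
    \<longleftrightarrow> (\<forall>j. exponent_sum j w = 0)"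
proof
  let ?F = "free_group n"
  interpret F: group ?F by (rule group_free_group)
  interpret N: normal "gamma3 ?F" ?F by (rule F.gamma3_normal)
  interpret D: subgroup "derived ?F (carrier ?F)" ?F
    by (rule F.derived_is_subgroup) simp
  assume "nil2_class n w \<in> derived (free_nil2 n) (carrier (free_nil2 n))"
  then obtain d where d: "d \<in> derived ?F (carrier ?F)"
    and eq: "gamma3 ?F #>\<^bsub>?F\<^esub> free_class n w = gamma3 ?F #>\<^bsub>?F\<^esub> d"
    by (auto simp: derived_free_nil2 nil2_class_def)
  have "free_class n w \<in> gamma3 ?F #>\<^bsub>?F\<^esub> d"
    using F.rcos_self[OF free_class_in_carrier[OF w] N.subgroup_axioms] by (simp add: eq)
  then obtain c where "c \<in> gamma3 ?F" "free_class n w = c \<otimes>\<^bsub>?F\<^esub> d"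
    by (auto simp: r_coset_def)
  then have "free_class n w \<in> derived ?F (carrier ?F)"
    using d F.gamma3_subset_derived by auto
  then show "\<forall>j. exponent_sum j w = 0"
    using exponent_sum_derived[OF w] by blast
next
  assume "\<forall>j. exponent_sum j w = 0"
  then show "nil2_class n w \<in> derived (free_nil2 n) (carrier (free_nil2 n))"
    using derived_if_exponent_sum_zero[OF w] by (auto simp: derived_free_nil2 nil2_class_def)
qed

lemma derived_free_nil2_central:
  assumes h: "h \<in> derived (free_nil2 n) (carrier (free_nil2 n))" and k: "k \<in> carrier (free_nil2 n)"
  shows "h \<otimes>\<^bsub>free_nil2 n\<^esub> k = k \<otimes>\<^bsub>free_nil2 n\<^esub> h"
proof -
  let ?F = "free_group n" and ?N = "free_nil2 n"
  let ?\<pi> = "\<lambda>x. gamma3 ?F #>\<^bsub>?F\<^esub> x"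
  interpret P: group_hom ?F ?N ?\<pi>
    by (rule group_hom_nil2_projection)
  interpret N: normal "gamma3 ?F" ?F by (rule P.G.gamma3_normal)
  obtain d where d: "d \<in> derived ?F (carrier ?F)" "h = ?\<pi> d"
    using h by (auto simp: derived_free_nil2)
  obtain g where g: "g \<in> carrier ?F" "k = ?\<pi> g"
    using k by (auto simp: free_nil2_def carrier_FactGroup)
  have dF: "d \<in> carrier ?F"
    using d(1) P.G.derived_in_carrier by blast
  let ?c = "d \<otimes>\<^bsub>?F\<^esub> g \<otimes>\<^bsub>?F\<^esub> inv\<^bsub>?F\<^esub> d \<otimes>\<^bsub>?F\<^esub> inv\<^bsub>?F\<^esub> g"
  have "?c \<in> gamma3 ?F"
    unfolding gamma3_def using d g by (intro generate.incl) blast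
  then have c: "?c \<in> carrier ?F" "?\<pi> ?c = \<one>\<^bsub>?N\<^esub>"
    using N.rcos_const[OF P.G.group_axioms] by (auto simp: free_nil2_def)
  have "h \<otimes>\<^bsub>?N\<^esub> k = ?\<pi> (?c \<otimes>\<^bsub>?F\<^esub> (g \<otimes>\<^bsub>?F\<^esub> d))"
    using dF g d(2) by (simp add: P.G.m_assoc P.G.inv_mult_cancel flip: P.hom_mult)
  also have "\<dots> = ?\<pi> ?c \<otimes>\<^bsub>?N\<^esub> ?\<pi> (g \<otimes>\<^bsub>?F\<^esub> d)"
    using c(1) dF g by (intro P.hom_mult) simp_all
  also have "\<dots> = k \<otimes>\<^bsub>?N\<^esub> h"
    unfolding c(2) using dF g d(2) by simp
  finally show ?thesis .
qed

lemma rev_words: "w \<in> words n \<Longrightarrow> rev w \<in> words n"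
  by (auto simp: in_lists_conv_set)

text \<open>
  Reversal is an anti-automorphism, so \<open>g \<mapsto> rev(g)\<^sup>-\<^sup>1\<close> is an endomorphism; a word and its reverse have
  the same exponent sums, so this endomorphism acts as inversion on the abelianization.
\<close>

lemma nil2_rev_derived:
  assumes p: "p \<in> derived (free_nil2 n) (carrier (free_nil2 n))"
  shows "nil2_rev n p = inv\<^bsub>free_nil2 n\<^esub> p"
proof -
  let ?N = "free_nil2 n"
  interpret N: group ?N by (rule group_free_nil2)
  define s where "s g = inv\<^bsub>?N\<^esub> nil2_rev n g" for g
  have s: "s (nil2_class n w) = nil2_class n (inv_word (rev w))" if "w \<in> words n" for w
    using that by (simp add: s_def nil2_rev_nil2_class inv_nil2_class rev_words)
  have "s \<in> hom ?N ?N"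
  proof (rule homI)
    fix x assume "x \<in> carrier ?N"
    then obtain u where "u \<in> words n" "x = nil2_class n u"
      by (auto simp only: carrier_free_nil2)
    then show "s x \<in> carrier ?N"
      by (simp add: s nil2_class_in_carrier inv_word_words rev_words)
  next
    fix x y assume "x \<in> carrier ?N" "y \<in> carrier ?N"
    then obtain u v where uv: "u \<in> words n" "v \<in> words n" "x = nil2_class n u" "y = nil2_class n v"
      by (auto simp only: carrier_free_nil2)
    then have "s (x \<otimes>\<^bsub>?N\<^esub> y) = nil2_class n (inv_word (rev (u @ v)))"
      using s[of "u @ v"] by (simp add: mult_nil2_class)
    also have "inv_word (rev (u @ v)) = inv_word (rev u) @ inv_word (rev v)"
      by (simp add: inv_word_def)
    also have "nil2_class n \<dots> = s x \<otimes>\<^bsub>?N\<^esub> s y"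
      using uv by (simp add: s mult_nil2_class inv_word_words rev_words del: rev_append)
    finally show "s (x \<otimes>\<^bsub>?N\<^esub> y) = s x \<otimes>\<^bsub>?N\<^esub> s y" .
  qed
  moreover have "s a \<otimes>\<^bsub>?N\<^esub> a \<in> derived ?N (carrier ?N)" if "a \<in> carrier ?N" for a
  proof -
    obtain u where u: "u \<in> words n" "a = nil2_class n u"
      using \<open>a \<in> carrier ?N\<close> by (auto simp only: carrier_free_nil2)
    have "inv_word (rev u) @ u \<in> words n"
      using inv_word_words[OF rev_words[OF u(1)]] u(1) by simp
    then show ?thesis
      using nil2_class_in_derived_iff[of "inv_word (rev u) @ u" n] u
      by (simp add: s mult_nil2_class inv_word_words rev_words)
  qed
  ultimately have "s p = p"
    using N.endomorphism_inverting_abelianization_fixes_derived derived_free_nil2_central p by blast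
  moreover have "nil2_rev n p \<in> carrier ?N"
  proof -
    have "p \<in> carrier ?N"
      using p N.derived_in_carrier by blast
    then obtain u where "u \<in> words n" "p = nil2_class n u"
      by (auto simp only: carrier_free_nil2)
    then show ?thesis
      by (simp add: nil2_rev_nil2_class nil2_class_in_carrier rev_words)
  qed
  ultimately show ?thesis
    unfolding s_def by (metis N.inv_inv)
qed

lemma endomorphism_fixing_nil2_gens:
  assumes f: "f \<in> hom (free_nil2 n) (free_nil2 n)"
    and gens: "\<And>i. i \<in> {1..n} \<Longrightarrow> f (nil2_gen n i) = nil2_gen n i"
    and g: "g \<in> carrier (free_nil2 n)"
  shows "f g = g"
proof -
  let ?N = "free_nil2 n"
  interpret f: group_hom ?N ?N f
    using f by (intro group_hom.intro group_hom_axioms.intro group_free_nil2)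
  have letter: "f (nil2_class n [x]) = nil2_class n [x]" if x: "x \<in> letters n" for x
  proof -
    obtain i b where ib: "x = (i, b)" "i \<in> {1..n}"
      using x by (auto simp: letters_def)
    then have wd: "[(i, True)] \<in> words n"
      by (simp add: letters_def)
    show ?thesis
    proof (cases b)
      case True
      then show ?thesis using ib gens[of i] by (simp add: nil2_gen_def)
    next
      case False
      then have "nil2_class n [x] = inv\<^bsub>?N\<^esub> nil2_gen n i"
        using inv_nil2_class[OF wd] by (simp add: nil2_gen_def inv_word_def ib)
      then show ?thesis
        using ib gens[of i] nil2_class_in_carrier[OF wd] by (simp add: nil2_gen_def)
    qed
  qed
  have "f (nil2_class n w) = nil2_class n w" if "w \<in> words n" for w
    using that
  proof (induction w)
    case Nil
    show ?case using f.hom_one by (simp add: one_nil2_class)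
  next
    case (Cons x w)
    have "nil2_class n (x # w) = nil2_class n [x] \<otimes>\<^bsub>?N\<^esub> nil2_class n w"
      using Cons.hyps by (simp add: mult_nil2_class)
    then show ?case
      using Cons letter by (simp add: nil2_class_in_carrier)
  qed
  then show ?thesis
    using g by (auto simp: carrier_free_nil2)
qed


section \<open>Elementary palindromic IA-automorphisms\<close>

text \<open>
  The exponent sums of \<open>rev(p) x\<^sub>i p x\<^sub>i\<^sup>-\<^sup>1\<close> are twice those of \<open>p\<close>, so this is where the absence of
  2-torsion in the abelianization enters.
\<close>

lemma palindromic_conjugator_in_derived:
  assumes p: "p \<in> carrier (free_nil2 n)" and i: "i \<in> {1..n}"
    and IA: "derived (free_nil2 n) (carrier (free_nil2 n)) #>\<^bsub>free_nil2 n\<^esub>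
        (nil2_rev n p \<otimes>\<^bsub>free_nil2 n\<^esub> nil2_gen n i \<otimes>\<^bsub>free_nil2 n\<^esub> p) =
      derived (free_nil2 n) (carrier (free_nil2 n)) #>\<^bsub>free_nil2 n\<^esub> nil2_gen n i"
  shows "p \<in> derived (free_nil2 n) (carrier (free_nil2 n))"
proof -
  let ?N = "free_nil2 n"
  interpret N: group ?N by (rule group_free_nil2)
  interpret D: subgroup "derived ?N (carrier ?N)" ?N
    by (rule N.derived_is_subgroup) simp
  obtain w where w: "w \<in> words n" "p = nil2_class n w"
    using p by (auto simp only: carrier_free_nil2)
  let ?x = "[(i, True)]"
  have x: "?x \<in> words n"
    using i by (simp add: letters_def)
  let ?v = "rev w @ ?x @ w"
  have v: "?v \<in> words n" "inv_word ?x \<in> words n"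
    using w x rev_words[OF w(1)] inv_word_words[OF x] by simp_all
  have "nil2_rev n p \<otimes>\<^bsub>?N\<^esub> nil2_gen n i \<otimes>\<^bsub>?N\<^esub> p = nil2_class n ?v"
    using w x rev_words[OF w(1)] mult_nil2_class[OF rev_words[OF w(1)] x]
      mult_nil2_class[of "rev w @ ?x" n w]
    by (simp add: nil2_rev_nil2_class nil2_gen_def)
  then have "nil2_class n ?v \<in> derived ?N (carrier ?N) #>\<^bsub>?N\<^esub> nil2_class n ?x"
    using IA N.rcos_self[OF nil2_class_in_carrier[OF v(1)] D.subgroup_axioms]
    by (simp add: nil2_gen_def)
  then have "nil2_class n ?v \<otimes>\<^bsub>?N\<^esub> inv\<^bsub>?N\<^esub> nil2_class n ?x \<in> derived ?N (carrier ?N)"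
    using D.rcos_module_imp[OF N.group_axioms nil2_class_in_carrier[OF x]] by blast
  then have "nil2_class n (?v @ inv_word ?x) \<in> derived ?N (carrier ?N)"
    using mult_nil2_class[OF v] inv_nil2_class[OF x] by simp
  moreover have "?v @ inv_word ?x \<in> words n"
    using v by simp
  ultimately have zero: "exponent_sum j (?v @ inv_word ?x) = 0" for j
    using nil2_class_in_derived_iff by blast
  have "exponent_sum j w = 0" for j
    using zero[of j] exponent_sum_Cons[of j "(i, True)" "w @ inv_word ?x"] by simp
  then show ?thesis
    using nil2_class_in_derived_iff[OF w(1)] w(2) by simp
qed

theorem proposition3p3:
  fixes n :: nat
  shows "PI_auto n = elem_pal_auto n \<inter> IA_auto (free_nil2 n) \<and>
    elem_pal_auto n \<inter> IA_auto (free_nil2 n) = {\<one>\<^bsub>AutoGroup (free_nil2 n)\<^esub>}"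
proof -
  let ?N = "free_nil2 n"
  let ?id = "\<lambda>x\<in>carrier ?N. x"
  interpret N: group ?N by (rule group_free_nil2)
  have gen: "nil2_gen n i \<in> carrier ?N" if "i \<in> {1..n}" for i
    using that by (simp add: nil2_gen_def nil2_class_in_carrier letters_def)
  have one: "\<one>\<^bsub>AutoGroup ?N\<^esub> = ?id"
    by (simp add: AutoGroup_def BijGroup_def)
  have "f = ?id" if f: "f \<in> elem_pal_auto n" "f \<in> IA_auto ?N" for f
  proof -
    have hom: "f \<in> hom ?N ?N" and ext: "f \<in> extensional (carrier ?N)"
      using f by (auto simp: elem_pal_auto_def auto_def Bij_def)
    obtain p where p: "p \<in> {1..n} \<rightarrow> carrier ?N"
      and fp: "\<And>i. i \<in> {1..n} \<Longrightarrow>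
        f (nil2_gen n i) = nil2_rev n (p i) \<otimes>\<^bsub>?N\<^esub> nil2_gen n i \<otimes>\<^bsub>?N\<^esub> p i"
      using f by (auto simp: elem_pal_auto_def)
    have "f (nil2_gen n i) = nil2_gen n i" if i: "i \<in> {1..n}" for i
    proof -
      have pi: "p i \<in> carrier ?N"
        using p i by auto
      have "derived ?N (carrier ?N) #>\<^bsub>?N\<^esub> f (nil2_gen n i) =
          derived ?N (carrier ?N) #>\<^bsub>?N\<^esub> nil2_gen n i"
        using f(2) gen[OF i] by (auto simp: IA_auto_def)
      then have D: "p i \<in> derived ?N (carrier ?N)"
        using palindromic_conjugator_in_derived[OF pi i] fp[OF i] by simp
      have "f (nil2_gen n i) = inv\<^bsub>?N\<^esub> p i \<otimes>\<^bsub>?N\<^esub> (nil2_gen n i \<otimes>\<^bsub>?N\<^esub> p i)"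
        using fp[OF i] nil2_rev_derived[OF D] pi gen[OF i] by (simp add: N.m_assoc)
      also have "nil2_gen n i \<otimes>\<^bsub>?N\<^esub> p i = p i \<otimes>\<^bsub>?N\<^esub> nil2_gen n i"
        using derived_free_nil2_central[OF D gen[OF i]] by simp
      finally show ?thesis
        using pi gen[OF i] by (simp add: N.inv_mult_cancel)
    qed
    then have "f g = g" if "g \<in> carrier ?N" for g
      using endomorphism_fixing_nil2_gens[OF hom] that by blast
    then show ?thesis
      using ext by (intro extensionalityI[of _ "carrier ?N"]) simp_all
  qed
  moreover have "?id \<in> elem_pal_auto n"
  proof -
    have "nil2_rev n \<one>\<^bsub>?N\<^esub> = \<one>\<^bsub>?N\<^esub>"
      using nil2_rev_nil2_class[of "[]" n] by (simp add: one_nil2_class)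
    then show ?thesis
      using N.id_in_auto gen
      by (auto simp: elem_pal_auto_def intro!: bexI[of _ "\<lambda>_. \<one>\<^bsub>?N\<^esub>"])
  qed
  moreover have "?id \<in> IA_auto ?N"
    using N.id_in_auto by (simp add: IA_auto_def)
  ultimately show ?thesis
    unfolding one PI_auto_def by blast
qed

end
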